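(* Any centrally symmetric convex body $K$ in $\mathbb{R}^3$ possesses an inscribed cube, centred at the centre of $K$.
   Context: A convex body is a compact convex set with non-empty interior. A cube is inscribed in $K$ if all its vertices lie on the boundary of $K$. *)

theory Defs
  imports "HOL-Analysis.Analysis"
begin

definition convex_body :: "'a::euclidean_space set \<Rightarrow> bool" where
  "convex_body K \<longleftrightarrow> compact K \<and> convex K \<and> interior K \<noteq> {}"

(* The reflection in c maps K into K; being an involution, it then maps K onto K. *)
definition symmetric_about :: "'a::real_vector \<Rightarrow> 'a set \<Rightarrow> bool" where
  "symmetric_about c K \<longleftrightarrow> (\<forall>x\<in>K. 2 *\<^sub>R c - x \<in> K)"

(* Solid, nondegenerate cubes in arbitrary position; the edge length is 2 * r. *)
definition cube_centred_at :: "real ^ 'n \<Rightarrow> (real ^ 'n) set \<Rightarrow> bool" where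
  "cube_centred_at c Q \<longleftrightarrow>
     (\<exists>(f :: real ^ 'n \<Rightarrow> real ^ 'n) r. orthogonal_transformation f \<and> 0 < r \<and>
            Q = (\<lambda>x. c + f x) ` cbox (- vec r) (vec r))"

(* The vertices of a polytope are its extreme points. *)
definition inscribed_in :: "'a::euclidean_space set \<Rightarrow> 'a set \<Rightarrow> bool" where
  "inscribed_in Q K \<longleftrightarrow> {v. v extreme_point_of Q} \<subseteq> frontier K"

end

theory Submission
  imports Defs
begin

text \<open>
  Move the centre of the body \<open>K\<close> to the origin. Its boundary is then described by an even radial function
  \<open>\<rho>\<close>, continuous by \<open>radial_function\<close>, and a turned cube can be scaled to be inscribed in \<open>K\<close> as soon as
  \<open>\<rho>\<close> takes the same value on its four space diagonals. Any even continuous function has this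
  property for some rotation (\<open>even_function_equal_on_cube_diagonals\<close>). To see this, choose on each diagonal one vertex, such that the four
  vertices \<open>v\<close> form a tetrahedron, and consider the sum of the vectors \<open>\<rho>(v) v\<close>. It vanishes
  exactly if the four values agree. It is unchanged by rotations of the cube that preserve the
  tetrahedron, and changes its sign under those that exchange the two tetrahedra in the cube.

  If the sum never vanished, its direction would be a map from the three-sphere, the double cover of the
  rotation group, to the two-sphere that is equivariant under a group of order 16, generated
  by a lifted quarter turn \<open>\<omega>\<close>, which acts on the target as the antipodal map, and by a lifted half turn, which acts trivially. Such a map
  does not exist (\<open>no_equivariant_map_to_sphere\<close>), for the following reason. Every map from the three-sphere to
  the two-sphere lifts through the Hopf map to a map into \<open>\<complex>\<^sup>2\<close> without zeros (\<open>spinor_lift_exists\<close>), and the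
  antipodal map lifts to the antilinear \<open>flip\<close>, whose square is \<open>-1\<close>. A lift is
  equivariant up to nonvanishing complex functions. The three-sphere being simply connected, these have
  logarithms. Were they constant, the constant belonging to \<open>j\<close> would be purely imaginary by the relation
  \<open>\<omega> j \<omega> = j\<close> of the group, as \<open>flip\<close> has square \<open>-1\<close>, and real by the relation
  \<open>j\<^sup>2 = \<omega>\<^sup>4\<close>. In general, adding up the arguments over an orbit gives the same
  contradiction as a parity count.
\<close>

section \<open>Spinors and Pauli matrices\<close>

text \<open>A spinor is a point of \<open>\<complex>\<^sup>2\<close>; the unit spinors form the three-sphere, which doubly
  covers the rotation group of three-space. Identify \<open>(a, b)\<close> with the quaternion \<open>a + cnj b j\<close>: then \<open>cscale (cis t)\<close> is right
  multiplication by \<open>cis t\<close> and \<open>flip\<close> is right multiplication by the quaternion \<open>j\<close>.\<close>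

type_synonym spinor = "complex \<times> complex"

declare split_paired_All [simp del] split_paired_Ex [simp del]

definition cscale :: "complex \<Rightarrow> spinor \<Rightarrow> spinor" where
  "cscale z h = (z * fst h, z * snd h)"

definition flip :: "spinor \<Rightarrow> spinor" where
  "flip h = (- cnj (snd h), cnj (fst h))"

text \<open>Writing a point of three-space as a real number \<open>t\<close> and a complex number \<open>s\<close>, this is the
Hermitian matrix \<open>(t, cnj s; s, -t)\<close>, the combination of the three Pauli matrices with
the coordinates of the point as coefficients. For a unit vector \<open>u\<close> it is a reflection, and \<open>u\<close> is recovered
from its line of fixed spinors: this is the Hopf map, from spinors up to a complex factor
to the unit sphere.\<close>

definition pauli :: "real \<times> complex \<Rightarrow> spinor \<Rightarrow> spinor" where
  "pauli u h = (of_real (fst u) * fst h + cnj (snd u) * snd h,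
                snd u * fst h - of_real (fst u) * snd h)"

lemma cscale_cscale: "cscale y (cscale z h) = cscale (y * z) h"
  by (simp add: cscale_def)

lemma cscale_1 [simp]: "cscale 1 h = h"
  by (simp add: cscale_def)

lemma cscale_eq_0_iff: "cscale z h = 0 \<longleftrightarrow> z = 0 \<or> h = 0"
  by (auto simp: cscale_def prod_eq_iff)

lemma cscale_cancel: "h \<noteq> 0 \<Longrightarrow> cscale y h = cscale z h \<longleftrightarrow> y = z"
  by (auto simp: cscale_def prod_eq_iff)

lemma cscale_minus_1: "cscale (- 1) h = - h"
  by (simp add: cscale_def prod_eq_iff)

lemma flip_cscale: "flip (cscale z h) = cscale (cnj z) (flip h)"
  by (simp add: cscale_def flip_def)

lemma flip_flip: "flip (flip h) = - h"
  by (simp add: flip_def prod_eq_iff)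

lemma flip_minus: "flip (- h) = - flip h"
  by (simp add: flip_def)

lemma flip_eq_0_iff [simp]: "flip h = 0 \<longleftrightarrow> h = 0"
  by (auto simp: flip_def prod_eq_iff)

lemma norm_spinor: "(norm (h :: spinor))\<^sup>2 = (cmod (fst h))\<^sup>2 + (cmod (snd h))\<^sup>2"
  by (cases h) (simp add: norm_Pair)

lemma norm_flip [simp]: "norm (flip h) = norm h"
  by (simp add: flip_def norm_prod_def add.commute)

lemma norm_cscale [simp]: "norm (cscale z h) = cmod z * norm h"
  by (simp add: cscale_def norm_prod_def norm_mult power_mult_distrib real_sqrt_mult
      flip: distrib_left)

lemma continuous_on_cscale [continuous_intros]:
  "continuous_on X z \<Longrightarrow> continuous_on X h \<Longrightarrow> continuous_on X (\<lambda>x. cscale (z x) (h x))"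
  unfolding cscale_def by (intro continuous_intros)

lemma continuous_on_flip [continuous_intros]:
  "continuous_on X h \<Longrightarrow> continuous_on X (\<lambda>x. flip (h x))"
  unfolding flip_def by (intro continuous_intros)

lemma continuous_on_pauli [continuous_intros]:
  "continuous_on X u \<Longrightarrow> continuous_on X h \<Longrightarrow> continuous_on X (\<lambda>x. pauli (u x) (h x))"
  unfolding pauli_def by (intro continuous_intros)

lemma pauli_add_left: "pauli (u + v) h = pauli u h + pauli v h"
  by (simp add: pauli_def algebra_simps)

lemma pauli_add_right: "pauli u (g + h) = pauli u g + pauli u h"
  by (simp add: pauli_def algebra_simps)

lemma pauli_minus_left: "pauli (- u) h = - pauli u h"
  by (simp add: pauli_def algebra_simps)

lemma pauli_cscale: "pauli u (cscale z h) = cscale z (pauli u h)"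
  by (simp add: pauli_def cscale_def algebra_simps)

text \<open>The sign says that \<open>flip\<close> exchanges the lines of fixed spinors of \<open>u\<close> and \<open>- u\<close>: on
the base of the Hopf map it is the antipodal map.\<close>

lemma pauli_flip: "pauli u (flip h) = - flip (pauli u h)"
  by (simp add: pauli_def flip_def algebra_simps)

lemma pauli_pauli: "pauli u (pauli u h) = (norm u)\<^sup>2 *\<^sub>R h"
proof -
  have "complex_of_real ((norm u)\<^sup>2) = of_real (fst u) * of_real (fst u) + snd u * cnj (snd u)"
    by (cases u) (simp add: norm_Pair complex_norm_square[symmetric] flip: power2_eq_square)
  then show ?thesis
    by (simp add: pauli_def prod_eq_iff scaleR_conv_of_real algebra_simps)
qed

lemma pauli_eq_0_imp:
  assumes "pauli u h = 0" "h \<noteq> 0"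
  shows "u = 0"
proof -
  have "(norm u)\<^sup>2 *\<^sub>R h = 0"
    using pauli_pauli[of u h] assms(1) by (simp add: pauli_def zero_prod_def)
  with assms(2) show ?thesis by simp
qed

lemma pauli_fixed_spinor_exists:
  assumes "norm u = 1"
  obtains h where "h \<noteq> 0" "pauli u h = h"
proof (cases "(1,0) + pauli u (1,0) = 0")
  case False
  have "pauli u ((1,0) + pauli u (1,0)) = (1,0) + pauli u (1,0)"
    using pauli_pauli[of u "(1,0)"] assms by (simp add: pauli_add_right add.commute)
  with False that show ?thesis by blast
next
  case True
  then have u: "complex_of_real (fst u) = - 1" "snd u = 0"
    by (auto simp: pauli_def prod_eq_iff add_eq_0_iff)
  have "pauli u (0,1) = (0,1)"
    using u by (simp add: pauli_def)
  with that[of "(0,1)"] show ?thesis by (simp add: prod_eq_iff)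
qed

text \<open>The Hermitian product of \<open>h\<close> and \<open>g\<close> over the squared norm of \<open>h\<close>: a formula for the
quotient of two proportional spinors that is visibly continuous.\<close>

definition ratio :: "spinor \<Rightarrow> spinor \<Rightarrow> complex" where
  "ratio g h = (cnj (fst h) * fst g + cnj (snd h) * snd g) / of_real ((norm h)\<^sup>2)"

lemma continuous_on_ratio [continuous_intros]:
  assumes "continuous_on X g" "continuous_on X h" "\<And>x. x \<in> X \<Longrightarrow> h x \<noteq> 0"
  shows "continuous_on X (\<lambda>x. ratio (g x) (h x))"
  unfolding ratio_def using assms(3) by (intro continuous_intros assms) auto

text \<open>The fixed spinors of a unit vector form a complex line, because the matrix has trace zero and
square one. Two lifts of the same map therefore differ by a nonvanishing complex function.\<close>

lemma cscale_ratio: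
  assumes u: "norm u = 1" and g: "pauli u g = g" and h: "pauli u h = h" "h \<noteq> 0"
  shows "cscale (ratio g h) h = g"
proof -
  obtain t s where ts: "u = (t, s)" by (cases u)
  obtain a b where ab: "g = (a, b)" by (cases g)
  obtain a' b' where ab': "h = (a', b')" by (cases h)
  have e: "of_real t * a + cnj s * b = a" "s * a - of_real t * b = b"
          "of_real t * a' + cnj s * b' = a'" "s * a' - of_real t * b' = b'"
    using g h by (auto simp: pauli_def ts ab ab')
  have det: "a * b' = a' * b"
  proof (cases "t = 1")
    case False
    have "(1 - of_real t) * a = cnj s * b" "(1 - of_real t) * a' = cnj s * b'"
      using e by (simp_all add: algebra_simps)
    then have "(1 - of_real t) * (a * b') = (1 - of_real t) * (a' * b)"
      by (metis mult.assoc mult.commute)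
    moreover have "1 - complex_of_real t \<noteq> 0"
      using False by (metis eq_iff_diff_eq_0 of_real_1 of_real_eq_iff)
    ultimately show ?thesis by simp
  next
    case True
    have "s = 0"
      using u True by (auto simp: ts norm_Pair)
    then show ?thesis using e True by auto
  qed
  have n: "complex_of_real ((norm h)\<^sup>2) = a' * cnj a' + b' * cnj b'"
    by (simp only: norm_spinor of_real_add complex_norm_square ab' fst_conv snd_conv)
  have nz: "complex_of_real ((norm h)\<^sup>2) \<noteq> 0"
    using h by simp
  have "(cnj a' * a + cnj b' * b) * a' = (a' * cnj a' + b' * cnj b') * a"
    using det by (simp add: algebra_simps)
  moreover have "(cnj a' * a + cnj b' * b) * b' = (a' * cnj a' + b' * cnj b') * b"
    using det by (simp add: algebra_simps)
  ultimately show ?thesis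
    using nz unfolding cscale_def ratio_def n by (simp add: ab ab' field_simps)
qed

lemma ratio_neq_0:
  assumes "norm u = 1" "pauli u g = g" "g \<noteq> 0" "pauli u h = h" "h \<noteq> 0"
  shows "ratio g h \<noteq> 0"
  using cscale_ratio[of u g h] assms by (metis cscale_eq_0_iff)

section \<open>Lifting sphere-valued maps through the Hopf map\<close>

text \<open>A lift of \<open>u\<close> through the Hopf map. Only the complex line of \<open>h x\<close> is prescribed, so lifts are not
normalised; this spares the proofs a division by the norm at each step.\<close>

definition spinor_lift :: "'a::topological_space set \<Rightarrow> ('a \<Rightarrow> real \<times> complex) \<Rightarrow> ('a \<Rightarrow> spinor) \<Rightarrow> bool" where
  "spinor_lift X u h \<longleftrightarrow> continuous_on X h \<and> (\<forall>x\<in>X. h x \<noteq> 0 \<and> pauli (u x) (h x) = h x)"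

text \<open>Homotopy lifting for the Hopf map. If two unit vectors are not antipodal, the
projection onto the fixed line of one does not kill the fixed line of the other. A homotopy on a
compact space moves every point by less than the diameter over a sufficiently short time, so a lift is carried along
by finitely many projections.\<close>

lemma spinor_lift_homotopy:
  fixes V :: "real \<times> 'a::metric_space \<Rightarrow> real \<times> complex"
  assumes X: "compact X" and V: "continuous_on ({0..1} \<times> X) V"
    and n1: "\<And>t x. t \<in> {0..1} \<Longrightarrow> x \<in> X \<Longrightarrow> norm (V (t, x)) = 1"
    and g0: "spinor_lift X (\<lambda>x. V (0, x)) g"
  shows "\<exists>h. spinor_lift X (\<lambda>x. V (1, x)) h"
proof -
  have "uniformly_continuous_on ({0..1} \<times> X) V"
    by (intro compact_uniformly_continuous V compact_Times X) auto
  then obtain d where d: "d > 0" "\<And>p q. \<lbrakk>p \<in> {0..1} \<times> X; q \<in> {0..1} \<times> X; dist q p < d\<rbrakk> \<Longrightarrow> dist (V q) (V p) < 2"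
    unfolding uniformly_continuous_on_def by (metis zero_less_numeral)
  obtain n :: nat where n: "n > 0" "1 / real n < d"
    using d(1) by (metis One_nat_def Suc_le_eq ex_least_nat_less inverse_eq_divide reals_Archimedean zero_less_Suc)
  have "k \<le> n \<Longrightarrow> \<exists>h. spinor_lift X (\<lambda>x. V (real k / real n, x)) h" for k
  proof (induction k)
    case 0
    then show ?case using g0 by auto
  next
    case (Suc k)
    then obtain h where h: "spinor_lift X (\<lambda>x. V (real k / real n, x)) h" by auto
    let ?V = "\<lambda>x. V (real (Suc k) / real n, x)"
    have in01: "real k / real n \<in> {0..1}" "real (Suc k) / real n \<in> {0..1}"
      using Suc.prems n by (auto simp: field_simps)
    have contV: "continuous_on X ?V"
      by (rule continuous_on_compose2[OF V]) (use in01 in \<open>auto intro!: continuous_intros\<close>)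
    \<comment> \<open>Half of \<open>h + pauli u h\<close> is the orthogonal projection of \<open>h\<close> onto the fixed line of \<open>u\<close>.\<close>
    have "spinor_lift X ?V (\<lambda>x. h x + pauli (?V x) (h x))"
      unfolding spinor_lift_def
    proof (intro conjI ballI)
      show "continuous_on X (\<lambda>x. h x + pauli (?V x) (h x))"
        using h contV by (intro continuous_intros) (auto simp: spinor_lift_def)
      fix x assume x: "x \<in> X"
      have hx: "h x \<noteq> 0" "pauli (V (real k / real n, x)) (h x) = h x"
        using h x by (auto simp: spinor_lift_def)
      show "pauli (?V x) (h x + pauli (?V x) (h x)) = h x + pauli (?V x) (h x)"
        using n1[OF in01(2) x] by (simp add: pauli_add_right pauli_pauli add.commute)
      show "h x + pauli (?V x) (h x) \<noteq> 0"
      proof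
        assume "h x + pauli (?V x) (h x) = 0"
        then have "pauli (V (real k / real n, x) + ?V x) (h x) = 0"
          by (simp add: pauli_add_left hx)
        then have "V (real k / real n, x) + ?V x = 0"
          using hx pauli_eq_0_imp by blast
        then have "V (real k / real n, x) = - ?V x"
          by (simp add: add_eq_0_iff2)
        then have "dist (?V x) (V (real k / real n, x)) = norm (2 *\<^sub>R ?V x)"
          by (simp add: dist_norm scaleR_2)
        then have "dist (?V x) (V (real k / real n, x)) = 2"
          using n1[OF in01(2) x] by simp
        moreover have "dist (real (Suc k) / real n, x) (real k / real n, x) < d"
          using n by (simp add: dist_Pair_Pair dist_real_def add_divide_distrib)
        then have "dist (?V x) (V (real k / real n, x)) < 2"
          using d(2)[of "(real k / real n, x)" "(real (Suc k) / real n, x)"] in01 x by auto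
        ultimately show False by simp
      qed
    qed
    then show ?case by blast
  qed
  from this[of n] show ?thesis using n by simp
qed

text \<open>A hemisphere contracts to its pole along normalised segments; the value at the pole has a
lift, and the contraction run backwards carries it to the whole hemisphere.\<close>

lemma spinor_lift_hemisphere:
  fixes N :: "'a::euclidean_space" and u :: "'a \<Rightarrow> real \<times> complex"
  assumes N: "norm N = 1" and u: "continuous_on (sphere 0 1) u" 
    and n1: "\<And>x. x \<in> sphere 0 1 \<Longrightarrow> norm (u x) = 1"
  shows "\<exists>h. spinor_lift {x \<in> sphere 0 1. 0 \<le> N \<bullet> x} u h"
proof -
  let ?X = "{x \<in> sphere 0 1. 0 \<le> N \<bullet> x}"
  define p where "p = (\<lambda>(t, x). (1 - t) *\<^sub>R N + t *\<^sub>R x)"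
  have NN: "N \<bullet> N = 1"
    using N by (simp add: norm_eq_1)
  have p0: "p (t, x) \<noteq> 0" if "t \<in> {0..1}" "x \<in> ?X" for t x
  proof
    assume 0: "p (t, x) = 0"
    have "N \<bullet> p (t, x) = (1 - t) + t * (N \<bullet> x)"
      by (simp add: p_def inner_add_right NN)
    moreover have "0 \<le> t * (N \<bullet> x)"
      using that by auto
    ultimately have "t = 1" using 0 that by auto
    with 0 that show False by (simp add: p_def)
  qed
  have "?X = sphere 0 1 \<inter> {x. 0 \<le> N \<bullet> x}"
    by auto
  then have X: "compact ?X"
    using compact_Int_closed[OF compact_sphere closed_halfspace_ge[of 0 N]] by metis
  define q where "q = (\<lambda>z. p z /\<^sub>R norm (p z))"
  have contq: "continuous_on ({0..1} \<times> ?X) q"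
    unfolding q_def using p0 by (intro continuous_intros) (auto simp: p_def case_prod_unfold intro!: continuous_intros)
  have q1: "q z \<in> sphere 0 1" if "z \<in> {0..1} \<times> ?X" for z
    using p0 that by (auto simp: q_def)
  have contV: "continuous_on ({0..1} \<times> ?X) (u \<circ> q)"
    by (rule continuous_on_compose) (use contq q1 in \<open>auto intro: continuous_on_subset[OF u]\<close>)
  have q_start: "q (0, x) = N" for x
    using N by (simp add: q_def p_def)
  have q_end: "q (1, x) = x" if "x \<in> ?X" for x
    using that by (simp add: q_def p_def)
  obtain g where "g \<noteq> 0" "pauli (u N) g = g"
    using pauli_fixed_spinor_exists[OF n1[of N]] N by auto
  then have "spinor_lift ?X (\<lambda>x. (u \<circ> q) (0, x)) (\<lambda>x. g)"
    by (simp add: spinor_lift_def q_start)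
  from spinor_lift_homotopy[OF X contV _ this] obtain h
    where "spinor_lift ?X (\<lambda>x. (u \<circ> q) (1, x)) h"
    using n1 q1 by fastforce
  then have "spinor_lift ?X u h"
    using q_end by (simp add: spinor_lift_def)
  then show ?thesis by blast
qed

lemma continuous_logarithm_on_sphere:
  fixes f :: "'a::euclidean_space \<Rightarrow> complex"
  assumes "3 \<le> DIM('a)" "continuous_on (sphere 0 1) f" "\<And>x. x \<in> sphere 0 1 \<Longrightarrow> f x \<noteq> 0"
  obtains l where "continuous_on (sphere 0 1) l" "\<And>x. x \<in> sphere 0 1 \<Longrightarrow> f x = exp (l x)"
proof -
  have "\<exists>l. continuous_on (sphere 0 1) l \<and> (\<forall>x\<in>sphere 0 1. f x = exp (l x))"
    using Borsukian_sphere[OF assms(1), of 0 1] assms(2,3) unfolding Borsukian_continuous_logarithm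
    by auto
  with that show ?thesis by blast
qed

text \<open>The equator of the three-sphere is a two-sphere, hence simply connected, so that logarithms
exist on it. Extending the logarithm beyond the equator is what allows one of two lifts to be corrected on a
whole hemisphere.\<close>

lemma continuous_logarithm_on_equator:
  fixes f :: "spinor \<Rightarrow> complex"
  assumes f: "continuous_on {x \<in> sphere 0 1. Re (snd x) = 0} f"
    and f0: "\<And>x. x \<in> sphere 0 1 \<Longrightarrow> Re (snd x) = 0 \<Longrightarrow> f x \<noteq> 0"
  obtains l where "continuous_on UNIV l"
    "\<And>x. x \<in> sphere 0 1 \<Longrightarrow> Re (snd x) = 0 \<Longrightarrow> f x = exp (l x)"
proof -
  let ?E = "{x :: spinor \<in> sphere 0 1. Re (snd x) = 0}"
  define e :: "complex \<times> real \<Rightarrow> spinor" where "e = (\<lambda>y. (fst y, \<i> * of_real (snd y)))"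
  define r :: "spinor \<Rightarrow> complex \<times> real" where "r = (\<lambda>x. (fst x, Im (snd x)))"
  have e: "e y \<in> ?E" if "y \<in> sphere 0 1" for y
    using that by (cases y) (simp add: e_def norm_Pair norm_mult)
  have er: "e (r x) = x" "r x \<in> sphere 0 1" if "x \<in> ?E" for x
  proof -
    have s: "snd x = \<i> * of_real (Im (snd x))"
      using that by (simp add: complex_eq_iff)
    show "e (r x) = x"
      using s by (simp add: e_def r_def prod_eq_iff)
    have "cmod (snd x) = \<bar>Im (snd x)\<bar>"
      by (subst s) (simp add: norm_mult)
    with that show "r x \<in> sphere 0 1"
      by (cases x) (simp add: r_def norm_Pair)
  qed
  have "continuous_on (sphere 0 1) (\<lambda>y. f (e y))"
    by (rule continuous_on_compose2[OF f])
       (use e in \<open>auto simp: e_def intro!: continuous_intros\<close>)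
  moreover have "f (e y) \<noteq> 0" if "y \<in> sphere 0 1" for y
    using e[OF that] f0 by auto
  ultimately obtain g where g: "continuous_on (sphere 0 1) g" 
    "\<And>y. y \<in> sphere 0 1 \<Longrightarrow> f (e y) = exp (g y)"
    using continuous_logarithm_on_sphere[of "\<lambda>y. f (e y)"] by auto
  have gr: "continuous_on ?E (\<lambda>x. g (r x))"
    by (rule continuous_on_compose2[OF g(1)])
       (use er in \<open>auto simp: r_def intro!: continuous_intros\<close>)
  have "closed ({x :: spinor. Re (snd x) = 0})"
    by (intro closed_Collect_eq continuous_intros)
  moreover have "?E = sphere 0 1 \<inter> {x. Re (snd x) = 0}"
    by auto
  ultimately have E: "compact ?E"
    using compact_Int_closed[OF compact_sphere] by metis
  then have "bounded ((\<lambda>x. g (r x)) ` ?E)"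
    using compact_continuous_image[OF gr] compact_imp_bounded by blast
  then obtain b where b: "0 < b" "\<forall>z\<in>(\<lambda>x. g (r x)) ` ?E. norm z \<le> b"
    unfolding bounded_pos by blast
  have clo: "closedin (top_of_set UNIV) ?E"
    using compact_imp_closed[OF E] by simp
  have "norm (g (r x)) \<le> b" if "x \<in> ?E" for x
    using b(2) that by blast
  from Tietze[OF gr clo less_imp_le[OF b(1)] this]
  obtain l where l: "continuous_on UNIV l" "\<And>x. x \<in> ?E \<Longrightarrow> l x = g (r x)"
    by (metis (no_types, lifting))
  show ?thesis
  proof (rule that[OF l(1)])
    fix x :: spinor assume "x \<in> sphere 0 1" "Re (snd x) = 0"
    then have "x \<in> ?E" by simp
    then show "f x = exp (l x)"
      using g(2)[of "r x"] er[of x] l(2) by simp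
  qed
qed

text \<open>Lifts on the two closed hemispheres differ on the equator by a nonvanishing complex
function. It is the exponential of a function defined everywhere, so the lift on the lower
hemisphere can be multiplied by that exponential to agree with the upper one.\<close>

lemma spinor_lift_exists:
  fixes u :: "spinor \<Rightarrow> real \<times> complex"
  assumes u: "continuous_on (sphere 0 1) u" 
    and n1: "\<And>x. x \<in> sphere 0 1 \<Longrightarrow> norm (u x) = 1"
  obtains h where "spinor_lift (sphere 0 1) u h"
proof -
  let ?P = "{x :: spinor \<in> sphere 0 1. 0 \<le> Re (snd x)}" 
    and ?M = "{x :: spinor \<in> sphere 0 1. Re (snd x) \<le> 0}"
  have N: "norm ((0, 1) :: spinor) = 1" "norm ((0, - 1) :: spinor) = 1"
    by (simp_all add: norm_Pair)
  have i: "((0, 1) :: spinor) \<bullet> x = Re (snd x)" "((0, - 1) :: spinor) \<bullet> x = - Re (snd x)" for x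
    by (cases x; simp add: inner_complex_def)+
  obtain h where h: "spinor_lift ?P u h"
    using spinor_lift_hemisphere[OF N(1) u n1] by (auto simp: i)
  obtain g where g: "spinor_lift ?M u g"
    using spinor_lift_hemisphere[OF N(2) u n1] by (auto simp: i)
  let ?E = "{x :: spinor \<in> sphere 0 1. Re (snd x) = 0}"
  have hE: "spinor_lift ?E u h" and gE: "spinor_lift ?E u g"
    using h g by (auto simp: spinor_lift_def elim: continuous_on_subset)
  have "continuous_on ?E (\<lambda>x. ratio (h x) (g x))"
    using hE gE by (intro continuous_intros) (auto simp: spinor_lift_def)
  moreover have "ratio (h x) (g x) \<noteq> 0" if "x \<in> sphere 0 1" "Re (snd x) = 0" for x
    using ratio_neq_0[OF n1[OF that(1)], of "h x" "g x"] hE gE that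
    by (simp add: spinor_lift_def)
  ultimately obtain l where l: "continuous_on UNIV l" 
    "\<And>x. x \<in> sphere 0 1 \<Longrightarrow> Re (snd x) = 0 \<Longrightarrow> ratio (h x) (g x) = exp (l x)"
    using continuous_logarithm_on_equator[of "\<lambda>x. ratio (h x) (g x)"] by blast
  define k where "k = (\<lambda>x. if Re (snd x) \<le> 0 then cscale (exp (l x)) (g x) else h x)"
  have "continuous_on (sphere 0 1) k"
    unfolding k_def
  proof (rule continuous_on_cases_le)
    show "continuous_on ?M (\<lambda>x. cscale (exp (l x)) (g x))"
      using g by (intro continuous_intros continuous_on_subset[OF l(1)]) (auto simp: spinor_lift_def)
    show "continuous_on ?P h"
      using h by (simp add: spinor_lift_def)
    show "continuous_on (sphere 0 1) (\<lambda>x :: spinor. Re (snd x))"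
      by (intro continuous_intros)
    fix x :: spinor assume x: "x \<in> sphere 0 1" "Re (snd x) = 0"
    then have "cscale (ratio (h x) (g x)) (g x) = h x"
      using cscale_ratio[OF n1[OF x(1)]] hE gE by (simp add: spinor_lift_def)
    then show "cscale (exp (l x)) (g x) = h x"
      using l(2)[OF x] by simp
  qed
  moreover have "k x \<noteq> 0 \<and> pauli (u x) (k x) = k x" if "x \<in> sphere 0 1" for x
    using h g that by (auto simp: k_def spinor_lift_def cscale_eq_0_iff pauli_cscale)
  ultimately show ?thesis
    using that[of k] by (simp add: spinor_lift_def)
qed

section \<open>No equivariant map from the three-sphere to the two-sphere\<close>

lemma continuous_exp_eq_1_imp_constant:
  fixes Z :: "'a::topological_space \<Rightarrow> complex"
  assumes "connected S" "continuous_on S Z" "\<And>x. x \<in> S \<Longrightarrow> exp (Z x) = 1"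
  obtains n :: int where "\<And>x. x \<in> S \<Longrightarrow> Im (Z x) = 2 * pi * n"
proof -
  have Im_Z: "\<exists>n::int. Im (Z x) = of_int (2 * n) * pi" if "x \<in> S" for x
    using assms(3)[OF that] unfolding exp_eq_1 by blast
  have "(\<lambda>x. Im (Z x)) constant_on S"
  proof (rule continuous_discrete_range_constant[OF assms(1)])
    show "continuous_on S (\<lambda>x. Im (Z x))"
      using assms(2) by (intro continuous_intros)
    fix x assume x: "x \<in> S"
    show "\<exists>e>0. \<forall>y. y \<in> S \<and> Im (Z y) \<noteq> Im (Z x) \<longrightarrow> e \<le> norm (Im (Z y) - Im (Z x))"
    proof (intro exI[of _ pi] conjI allI impI)
      fix y assume y: "y \<in> S \<and> Im (Z y) \<noteq> Im (Z x)"
      obtain m n :: int where mn: "Im (Z y) = of_int (2 * m) * pi" "Im (Z x) = of_int (2 * n) * pi"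
        using Im_Z x y by metis
      then have "Im (Z y) - Im (Z x) = of_int (2 * (m - n)) * pi" "m - n \<noteq> 0"
        using y by (auto simp: algebra_simps)
      moreover have "1 \<le> \<bar>real_of_int (2 * (m - n))\<bar>"
        using \<open>m - n \<noteq> 0\<close> by (simp flip: of_int_diff of_int_abs)
      ultimately show "pi \<le> norm (Im (Z y) - Im (Z x))"
        by (simp add: abs_mult)
    qed simp
  qed
  then obtain c where c: "\<And>x. x \<in> S \<Longrightarrow> Im (Z x) = c"
    unfolding constant_on_def by blast
  show ?thesis
  proof (cases "S = {}")
    case False
    then obtain x where "x \<in> S" by blast
    then obtain n :: int where "c = of_int (2 * n) * pi"
      using Im_Z c by metis
    with c that[of n] show ?thesis by (simp add: mult.commute mult.left_commute)
  qed (use that in auto)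
qed

text \<open>Right multiplication by this root of unity turns a frame by a quarter turn about
its first axis. Together with \<open>flip\<close> it generates a group of order 16, the generalised quaternion group, acting
freely on the unit spinors.\<close>

definition \<omega> :: complex where "\<omega> = cis (pi / 4)"

lemma omega_power_4: "\<omega> ^ 4 = - 1"
  by (simp only: \<omega>_def Complex.DeMoivre) simp

lemma omega_power_8: "\<omega> ^ 8 = 1"
  using power_mult[of \<omega> 4 2] omega_power_4 by simp

lemma omega_cnj: "\<omega> * cnj \<omega> = 1" 
  using complex_norm_square[of \<omega>] by (simp add: \<omega>_def)

lemma norm_omega [simp]: "cmod \<omega> = 1"
  by (simp add: \<omega>_def)

lemma cnj_omega: "cnj \<omega> = \<omega> ^ 7"
proof -
  have "\<omega> * cnj \<omega> = \<omega> * \<omega> ^ 7"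
    using omega_cnj omega_power_8 by (simp add: power_Suc[symmetric] del: power_Suc)
  then show ?thesis by (metis mult_left_cancel norm_omega norm_zero zero_neq_one)
qed

text \<open>The sum over one orbit of the group of order 16: the images of the spinor \<open>(1, 0)\<close> are the
spinors \<open>(\<omega>\<^sup>k, 0)\<close> and \<open>(0, \<omega>\<^sup>k)\<close>.\<close>

definition orbit_sum :: "(spinor \<Rightarrow> real) \<Rightarrow> real" where
  "orbit_sum \<phi> = (\<Sum>k<8. \<phi> (cscale (\<omega> ^ k) (1, 0)) + \<phi> (cscale (\<omega> ^ k) (0, 1)))"

lemma orbit_sum_simps:
  "orbit_sum (\<lambda>x. \<phi> x + \<psi> x) = orbit_sum \<phi> + orbit_sum \<psi>"
  "orbit_sum (\<lambda>x. \<phi> x - \<psi> x) = orbit_sum \<phi> - orbit_sum \<psi>"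
  "orbit_sum (\<lambda>x. c) = 16 * c"
  by (simp_all add: orbit_sum_def sum.distrib sum_subtractf)

lemma orbit_sum_cong: 
  assumes "\<And>x. x \<in> sphere 0 1 \<Longrightarrow> \<phi> x = \<psi> x"
  shows "orbit_sum \<phi> = orbit_sum \<psi>"
proof -
  have "norm (cscale (\<omega> ^ k) (1, 0)) = 1" "norm (cscale (\<omega> ^ k) (0, 1)) = 1" for k
    by (simp_all add: norm_cscale norm_power norm_Pair)
  then show ?thesis
    by (simp add: orbit_sum_def assms)
qed

text \<open>The reindexings of an orbit under the two generators: the factor 7 is complex conjugation and the summand 4 the sign of
\<open>flip\<close>, in exponents of \<open>\<omega>\<close>.\<close>

lemma sum_periodic_8:
  fixes F :: "nat \<Rightarrow> real"
  assumes "\<And>k. F (k + 8) = F k"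
  shows "(\<Sum>k<8. F (k + 1)) = (\<Sum>k<8. F k)"
    and "(\<Sum>k<8. F (7 * k)) = (\<Sum>k<8. F k)"
    and "(\<Sum>k<8. F (7 * k + 4)) = (\<Sum>k<8. F k)"
proof -
  have F: "F n = F (n mod 8)" for n
  proof -
    have "F (m + 8 * j) = F m" for m j
    proof (induction j)
      case (Suc j)
      have "m + 8 * Suc j = (m + 8 * j) + 8" by simp
      with Suc assms[of "m + 8 * j"] show ?case by metis
    qed simp
    from this[of "n mod 8" "n div 8"] show ?thesis by simp
  qed
  have e: "{..<8} = {0,1,2,3,4,5,6,7::nat}" by auto
  show "(\<Sum>k<8. F (k + 1)) = (\<Sum>k<8. F k)"
    unfolding e using F[of 8] by (simp flip: numeral_2_eq_2)
  show "(\<Sum>k<8. F (7 * k)) = (\<Sum>k<8. F k)"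
    unfolding e using F[of 14] F[of 21] F[of 28] F[of 35] F[of 42] F[of 49] by simp
  show "(\<Sum>k<8. F (7 * k + 4)) = (\<Sum>k<8. F k)"
    unfolding e using F[of 11] F[of 18] F[of 25] F[of 32] F[of 39] F[of 46] F[of 53] by simp
qed

lemma orbit_sum_cscale: "orbit_sum (\<lambda>x. \<phi> (cscale \<omega> x)) = orbit_sum \<phi>"
proof -
  have *: "cscale \<omega> (cscale (\<omega> ^ k) h) = cscale (\<omega> ^ (k + 1)) h" for k h
    by (simp add: cscale_cscale)
  have p: "cscale (\<omega> ^ (k + 8)) h = cscale (\<omega> ^ k) h" for k h
    by (simp add: power_add omega_power_8)
  show ?thesis
    unfolding orbit_sum_def * sum.distrib
    using sum_periodic_8(1)[of "\<lambda>k. \<phi> (cscale (\<omega> ^ k) (1, 0))"]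
      sum_periodic_8(1)[of "\<lambda>k. \<phi> (cscale (\<omega> ^ k) (0, 1))"]
    by (simp only: p)
qed

lemma orbit_sum_flip: "orbit_sum (\<lambda>x. \<phi> (flip x)) = orbit_sum \<phi>"
proof -
  have p: "cscale (\<omega> ^ (k + 8)) h = cscale (\<omega> ^ k) h" for k h
    by (simp add: power_add omega_power_8)
  have 1: "flip (cscale (\<omega> ^ k) (1, 0)) = cscale (\<omega> ^ (7 * k)) (0, 1)" for k
    by (simp add: cscale_def flip_def cnj_omega power_mult)
  have 2: "flip (cscale (\<omega> ^ k) (0, 1)) = cscale (\<omega> ^ (7 * k + 4)) (1, 0)" for k
    by (simp add: cscale_def flip_def cnj_omega power_mult power_add omega_power_4)
  show ?thesis
    unfolding orbit_sum_def 1 2 sum.distrib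
    using sum_periodic_8(2)[of "\<lambda>k. \<phi> (cscale (\<omega> ^ k) (0, 1))"]
      sum_periodic_8(3)[of "\<lambda>k. \<phi> (cscale (\<omega> ^ k) (1, 0))"]
    by (simp only: p)
qed

text \<open>A lift \<open>h\<close> of such a map satisfies \<open>h (\<omega> x) = a x \<cdot> flip (h x)\<close> and
\<open>h (flip x) = b x \<cdot> h x\<close> for nonvanishing functions \<open>a\<close> and \<open>b\<close>, which have logarithms
since the three-sphere is simply connected. Each relation between the generators of the group gives an identity
between \<open>a\<close> and \<open>b\<close>, hence an equation between arguments up to a constant multiple of \<open>2 \<pi>\<close>. In
sums over an orbit the arguments of \<open>a\<close> cancel. The relation \<open>\<omega> \<cdot> flip (\<omega> x) = flip x\<close> makes the
orbit sum of the argument of \<open>b\<close> an odd multiple of \<open>8 \<pi>\<close>, because \<open>flip\<close> has square \<open>-1\<close>; the relation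
\<open>flip (flip x) = \<omega>\<^sup>4 x\<close> makes it an even one.\<close>

theorem no_equivariant_map_to_sphere:
  fixes u :: "spinor \<Rightarrow> real \<times> complex"
  assumes u: "continuous_on (sphere 0 1) u" 
    and n1: "\<And>x. x \<in> sphere 0 1 \<Longrightarrow> norm (u x) = 1"
    and u_cscale: "\<And>x. x \<in> sphere 0 1 \<Longrightarrow> u (cscale \<omega> x) = - u x"
    and u_flip: "\<And>x. x \<in> sphere 0 1 \<Longrightarrow> u (flip x) = u x"
  shows False
proof -
  let ?S = "sphere 0 1 :: spinor set"
  obtain h where h: "spinor_lift ?S u h"
    using spinor_lift_exists[OF u n1] by blast
  have conth: "continuous_on ?S h" 
    and h0: "\<And>x. x \<in> ?S \<Longrightarrow> h x \<noteq> 0" 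
    and hu: "\<And>x. x \<in> ?S \<Longrightarrow> pauli (u x) (h x) = h x"
    using h by (auto simp: spinor_lift_def)
  have S [simp]: "cscale \<omega> x \<in> ?S" "flip x \<in> ?S" if "x \<in> ?S" for x
    using that by (simp_all add: norm_cscale)
  define a where "a = (\<lambda>x. ratio (h (cscale \<omega> x)) (flip (h x)))"
  define b where "b = (\<lambda>x. ratio (h (flip x)) (h x))"
  have flip_hu: "pauli (u (cscale \<omega> x)) (flip (h x)) = flip (h x)" if "x \<in> ?S" for x
    using that by (simp only: u_cscale pauli_minus_left pauli_flip hu flip_minus minus_minus)
  have a: "h (cscale \<omega> x) = cscale (a x) (flip (h x))" and a0: "a x \<noteq> 0" if "x \<in> ?S" for x
    unfolding a_def
    using cscale_ratio[OF n1 hu flip_hu, of x] ratio_neq_0[OF n1 hu h0 flip_hu, of x] 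
      that h0 by (simp_all add: norm_cscale)
  have hu_flip: "pauli (u x) (h (flip x)) = h (flip x)" if "x \<in> ?S" for x
    using that hu[of "flip x"] u_flip by simp
  have b: "h (flip x) = cscale (b x) (h x)" and b0: "b x \<noteq> 0" if "x \<in> ?S" for x
    unfolding b_def
    using cscale_ratio[OF n1 hu_flip hu, of x] ratio_neq_0[OF n1 hu_flip _ hu, of x] 
      that h0 by simp_all
  have cont_cscale: "continuous_on ?S (\<lambda>x. f (cscale \<omega> x))" 
    and cont_flip: "continuous_on ?S (\<lambda>x. f (flip x))"
    if "continuous_on ?S f" for f :: "spinor \<Rightarrow> 'b::topological_space"
    by (rule continuous_on_compose2[OF that]; use S in \<open>auto intro!: continuous_intros\<close>)+
  have "continuous_on ?S a"
    unfolding a_def using h0 by (intro continuous_intros conth cont_cscale) auto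
  then obtain A where A: "continuous_on ?S A" "\<And>x. x \<in> ?S \<Longrightarrow> a x = exp (A x)"
    using continuous_logarithm_on_sphere[of a] a0 by auto
  have "continuous_on ?S b"
    unfolding b_def using h0 by (intro continuous_intros conth cont_flip) auto
  then obtain B where B: "continuous_on ?S B" "\<And>x. x \<in> ?S \<Longrightarrow> b x = exp (B x)"
    using continuous_logarithm_on_sphere[of b] b0 by auto
  have conn: "connected ?S"
    by (rule connected_sphere) simp

  \<comment> \<open>The difference of the logarithms of the two sides of the relation \<open>\<omega> \<cdot> flip (\<omega> x) = flip x\<close>;
    the summand \<open>\<i> * pi\<close> accounts for the square of \<open>flip\<close>.\<close>
  define Z where "Z = (\<lambda>x. A (flip (cscale \<omega> x)) + cnj (B (cscale \<omega> x)) + cnj (A x) - B x + \<i> * pi)"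
  have "exp (Z x) = 1" if x: "x \<in> ?S" for x
  proof -
    have "cscale \<omega> (flip (cscale \<omega> x)) = flip x"
      by (simp add: flip_cscale cscale_cscale omega_cnj)
    then have "cscale (b x) (h x) = h (cscale \<omega> (flip (cscale \<omega> x)))"
      using b[OF x] by simp
    also have "\<dots> = cscale (a (flip (cscale \<omega> x))) (flip (cscale (b (cscale \<omega> x)) (cscale (a x) (flip (h x)))))"
      using a[of "flip (cscale \<omega> x)"] b[of "cscale \<omega> x"] a[of x] S x by metis
    also have "\<dots> = cscale (a (flip (cscale \<omega> x)) * cnj (b (cscale \<omega> x)) * cnj (a x)) (- h x)"
      by (simp add: flip_cscale cscale_cscale flip_flip mult.assoc)
    also have "\<dots> = cscale (- (a (flip (cscale \<omega> x)) * cnj (b (cscale \<omega> x)) * cnj (a x))) (h x)"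
      by (simp add: cscale_def)
    finally have "b x = - (a (flip (cscale \<omega> x)) * cnj (b (cscale \<omega> x)) * cnj (a x))"
      using cscale_cancel h0[OF x] by blast
    then show ?thesis
      using x b0[OF x] by (simp add: Z_def exp_add exp_diff A B exp_cnj field_simps)
  qed
  moreover have "continuous_on ?S Z"
    unfolding Z_def by (intro continuous_intros cont_cscale cont_flip A B)
  ultimately obtain m :: int where m: "\<And>x. x \<in> ?S \<Longrightarrow> Im (Z x) = 2 * pi * m"
    using continuous_exp_eq_1_imp_constant[OF conn, of Z] by blast

  \<comment> \<open>The same for the relation \<open>flip (flip x) = \<omega>\<^sup>4 x\<close>. Applied to \<open>h\<close>, the right-hand side contributes
    \<open>flip\<close> four times, so that no sign remains.\<close>
  define W where "W = (\<lambda>x. A (cscale \<omega> (cscale \<omega> (cscale \<omega> x))) + cnj (A (cscale \<omega> (cscale \<omega> x))) 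
      + A (cscale \<omega> x) + cnj (A x) - B (flip x) - B x)"
  have "exp (W x) = 1" if x: "x \<in> ?S" for x
  proof -
    let ?a = "a (cscale \<omega> (cscale \<omega> (cscale \<omega> x))) * cnj (a (cscale \<omega> (cscale \<omega> x)))
        * a (cscale \<omega> x) * cnj (a x)"
    have "cscale \<omega> (cscale \<omega> (cscale \<omega> (cscale \<omega> x))) = cscale (\<omega> ^ 4) x"
      by (simp add: cscale_cscale power4_eq_xxxx mult.assoc)
    then have "cscale \<omega> (cscale \<omega> (cscale \<omega> (cscale \<omega> x))) = flip (flip x)"
      by (simp add: omega_power_4 cscale_minus_1 flip_flip)
    moreover have "h (flip (flip x)) = cscale (b (flip x) * b x) (h x)"
      using x by (simp add: b cscale_cscale)
    moreover have "h (cscale \<omega> (cscale \<omega> (cscale \<omega> (cscale \<omega> x)))) = cscale ?a (h x)"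
    proof -
      have "h (cscale \<omega> (cscale \<omega> (cscale \<omega> (cscale \<omega> x)))) =
          cscale (a (cscale \<omega> (cscale \<omega> (cscale \<omega> x)))) (flip (cscale (a (cscale \<omega> (cscale \<omega> x)))
            (flip (cscale (a (cscale \<omega> x)) (flip (cscale (a x) (flip (h x))))))))"
        using a[of "cscale \<omega> (cscale \<omega> (cscale \<omega> x))"] a[of "cscale \<omega> (cscale \<omega> x)"]
          a[of "cscale \<omega> x"] a[of x] S x by metis
      also have "\<dots> = cscale ?a (h x)"
        by (simp add: flip_cscale cscale_cscale flip_flip flip_minus mult.assoc)
      finally show ?thesis .
    qed
    ultimately have "b (flip x) * b x = ?a"
      using cscale_cancel h0[OF x] by metis
    then show ?thesis
      using x b0[OF x] b0[of "flip x"] by (simp add: W_def exp_add exp_diff A B exp_cnj field_simps)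
  qed
  moreover have "continuous_on ?S W"
    unfolding W_def by (intro continuous_intros cont_cscale cont_flip A B)
  ultimately obtain n :: int where n: "\<And>x. x \<in> ?S \<Longrightarrow> Im (W x) = 2 * pi * n"
    using continuous_exp_eq_1_imp_constant[OF conn, of W] by blast

  have Z_sum: "orbit_sum (\<lambda>x. Im (Z x)) = 16 * pi - 2 * orbit_sum (\<lambda>x. Im (B x))"
    using orbit_sum_cscale[of "\<lambda>x. Im (A (flip x))"] orbit_sum_flip[of "\<lambda>x. Im (A x)"] 
      orbit_sum_cscale[of "\<lambda>x. Im (B x)"]
    by (simp add: Z_def orbit_sum_simps)
  have W_sum: "orbit_sum (\<lambda>x. Im (W x)) = - 2 * orbit_sum (\<lambda>x. Im (B x))"
    using orbit_sum_cscale[of "\<lambda>x. Im (A (cscale \<omega> (cscale \<omega> x)))"] 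
      orbit_sum_cscale[of "\<lambda>x. Im (A (cscale \<omega> x))"] orbit_sum_cscale[of "\<lambda>x. Im (A x)"] 
      orbit_sum_flip[of "\<lambda>x. Im (B x)"]
    by (simp add: W_def orbit_sum_simps)
  have "orbit_sum (\<lambda>x. Im (Z x)) = 32 * pi * m" "orbit_sum (\<lambda>x. Im (W x)) = 32 * pi * n"
    using orbit_sum_cong[OF m] orbit_sum_cong[OF n] by (simp_all add: orbit_sum_simps)
  with Z_sum W_sum have "16 * pi = 32 * pi * m - 32 * pi * n"
    by linarith
  also have "\<dots> = 16 * pi * (2 * (real_of_int m - real_of_int n))"
    by (simp only: right_diff_distrib mult.assoc)
  finally have "2 * (real_of_int m - real_of_int n) = 1"
    by (metis mult_cancel_left1 mult_eq_0_iff pi_neq_zero zero_neq_numeral)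
  then have "real_of_int (2 * (m - n)) = real_of_int 1"
    by simp
  then have "2 * (m - n) = 1"
    by (simp only: of_int_eq_iff)
  then show False by presburger
qed

section \<open>Even functions on the diagonals of a cube\<close>

text \<open>An orthonormal frame that turns with the unit spinor \<open>(a, b)\<close>; through it, the three-sphere
doubly covers the orthonormal frames of one orientation. The first axis is
the image of the spinor under the Hopf map; the other two are the real part and minus the imaginary
part of the isotropic vector with components \<open>-2 \<i> a b\<close>, \<open>\<i> (a\<^sup>2 - b\<^sup>2)\<close> and \<open>- (a\<^sup>2 + b\<^sup>2)\<close>, whose entries are quadratic
in the spinor.\<close>

definition frame1 :: "spinor \<Rightarrow> real ^ 3" where
  "frame1 x = vector [(cmod (fst x))\<^sup>2 - (cmod (snd x))\<^sup>2, 
     2 * Re (cnj (fst x) * snd x), 2 * Im (cnj (fst x) * snd x)]"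

definition frame2 :: "spinor \<Rightarrow> real ^ 3" where
  "frame2 x = vector [2 * Im (fst x * snd x), 
     - Im ((fst x)\<^sup>2 - (snd x)\<^sup>2), - Re ((fst x)\<^sup>2 + (snd x)\<^sup>2)]"

definition frame3 :: "spinor \<Rightarrow> real ^ 3" where
  "frame3 x = vector [2 * Re (fst x * snd x), 
     - Re ((fst x)\<^sup>2 - (snd x)\<^sup>2), Im ((fst x)\<^sup>2 + (snd x)\<^sup>2)]"

lemmas frame_defs = frame1_def frame2_def frame3_def

lemma omega_power_2: "\<omega>\<^sup>2 = \<i>"
  by (simp only: \<omega>_def Complex.DeMoivre) (simp add: complex_eq_iff)

lemma frame_cscale:
  "frame1 (cscale \<omega> x) = frame1 x" 
  "frame2 (cscale \<omega> x) = frame3 x"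
  "frame3 (cscale \<omega> x) = - frame2 x"
proof -
  have "cnj (\<omega> * p) * (\<omega> * q) = cnj p * q" for p q
  proof -
    have "cnj (\<omega> * p) * (\<omega> * q) = (\<omega> * cnj \<omega>) * (cnj p * q)" by simp
    then show ?thesis by (simp only: omega_cnj mult_1_left)
  qed
  then show "frame1 (cscale \<omega> x) = frame1 x" 
    by (simp only: frame1_def cscale_def fst_conv snd_conv norm_mult norm_omega mult_1_left)
  have prod: "(\<omega> * p) * (\<omega> * q) = \<i> * (p * q)" for p q
    by (simp flip: omega_power_2 add: power2_eq_square)
  then show "frame2 (cscale \<omega> x) = frame3 x" "frame3 (cscale \<omega> x) = - frame2 x"
    unfolding frame2_def frame3_def cscale_def fst_conv snd_conv prod power_mult_distrib omega_power_2
    by (simp_all add: vec_eq_iff forall_3 vector_3)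
qed

lemma frame_flip:
  "frame1 (flip x) = - frame1 x" 
  "frame2 (flip x) = frame2 x"
  "frame3 (flip x) = - frame3 x"
  by (simp_all add: frame_defs flip_def vec_eq_iff forall_3 vector_3 power2_eq_square)


lemma frame_orthogonal:
  "frame1 x \<bullet> frame2 x = 0" "frame1 x \<bullet> frame3 x = 0" "frame2 x \<bullet> frame3 x = 0"
proof -
  show "frame1 x \<bullet> frame2 x = 0"
    by (simp add: frame_defs inner_vec_def sum_3 vector_3 cmod_power2 Re_power2 Im_power2) algebra
  show "frame1 x \<bullet> frame3 x = 0"
    by (simp add: frame_defs inner_vec_def sum_3 vector_3 cmod_power2 Re_power2 Im_power2) algebra
  show "frame2 x \<bullet> frame3 x = 0"
    by (simp add: frame_defs inner_vec_def sum_3 vector_3 cmod_power2 Re_power2 Im_power2) algebra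
qed

lemma frame_unit:
  assumes "x \<in> sphere 0 1"
  shows "frame1 x \<bullet> frame1 x = 1" "frame2 x \<bullet> frame2 x = 1" "frame3 x \<bullet> frame3 x = 1"
proof -
  have 1: "(Re (fst x))\<^sup>2 + (Im (fst x))\<^sup>2 + ((Re (snd x))\<^sup>2 + (Im (snd x))\<^sup>2) = 1"
    using assms norm_spinor[of x] by (simp add: cmod_power2)
  show "frame1 x \<bullet> frame1 x = 1"
    using 1 by (simp add: frame_defs inner_vec_def sum_3 vector_3 cmod_power2 Re_power2 Im_power2) algebra
  show "frame2 x \<bullet> frame2 x = 1"
    using 1 by (simp add: frame_defs inner_vec_def sum_3 vector_3 cmod_power2 Re_power2 Im_power2) algebra
  show "frame3 x \<bullet> frame3 x = 1"
    using 1 by (simp add: frame_defs inner_vec_def sum_3 vector_3 cmod_power2 Re_power2 Im_power2) algebra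
qed

lemma continuous_on_vector_3:
  fixes f g h :: "'a::topological_space \<Rightarrow> real"
  assumes "continuous_on S f" "continuous_on S g" "continuous_on S h"
  shows "continuous_on S (\<lambda>x. vector [f x, g x, h x] :: real ^ 3)"
proof -
  have "continuous_on S (\<lambda>x. \<chi> i. (vector [f x, g x, h x] :: real ^ 3) $ i)"
  proof (rule continuous_on_vec_lambda)
    show "continuous_on S (\<lambda>x. (vector [f x, g x, h x] :: real ^ 3) $ i)" for i
      using exhaust_3[of i] assms by (auto simp: vector_3)
  qed
  then show ?thesis by simp
qed

lemma continuous_on_frame [continuous_intros]:
  "continuous_on S frame1" "continuous_on S frame2" "continuous_on S frame3"
  unfolding frame_defs by (intro continuous_on_vector_3 continuous_intros)+

text \<open>Four vertices of the cube with edge length 2 whose edges are parallel to the frame. They form a regular tetrahedron, one on each space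
diagonal; the other four vertices are their negatives. All indices from 3 on denote the
same vertex.\<close>

definition vertex :: "nat \<Rightarrow> spinor \<Rightarrow> real ^ 3" where
  "vertex k x = 
    (if k = 0 then frame1 x + frame2 x + frame3 x
     else if k = 1 then frame1 x - frame2 x - frame3 x
     else if k = 2 then - frame1 x + frame2 x - frame3 x
     else - frame1 x - frame2 x + frame3 x)"

text \<open>A quarter turn exchanges the two tetrahedra inscribed in the cube, whereas \<open>flip\<close>, a half turn, preserves each of
them.\<close>

lemma vertex_cscale:
  "vertex 0 (cscale \<omega> x) = - vertex 2 x" "vertex 1 (cscale \<omega> x) = - vertex 3 x"
  "vertex 2 (cscale \<omega> x) = - vertex 1 x" "vertex 3 (cscale \<omega> x) = - vertex 0 x"
  by (simp_all add: vertex_def frame_cscale)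

lemma vertex_flip:
  "vertex 0 (flip x) = vertex 2 x" "vertex 1 (flip x) = vertex 3 x"
  "vertex 2 (flip x) = vertex 0 x" "vertex 3 (flip x) = vertex 1 x"
  by (simp_all add: vertex_def frame_flip)

lemma norm_vertex:
  assumes "x \<in> sphere 0 1"
  shows "norm (vertex k x) = sqrt 3"
  by (simp add: vertex_def norm_eq_sqrt_inner inner_add inner_diff frame_unit[OF assms] 
      frame_orthogonal frame_orthogonal[THEN trans[OF inner_commute]])

lemma continuous_on_vertex: "continuous_on S (vertex k)"
  unfolding vertex_def by (cases "k = 0"; cases "k = 1"; cases "k = 2"; simp; intro continuous_intros)

text \<open>Weight each of the four vertices of a tetrahedron by the value of \<open>\<phi>\<close> there and add them up to a vector
\<open>H\<close>. The vertices add up to zero and any three of them are linearly independent, so \<open>H\<close> vanishes exactly if the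
values agree. As \<open>\<phi>\<close> is even, \<open>H\<close> changes its sign when the cube makes a quarter turn and is unchanged by \<open>flip\<close>.
If it had no zero, its direction would be an equivariant map to the sphere.\<close>

lemma even_function_equal_on_cube_diagonals:
  fixes \<phi> :: "real ^ 3 \<Rightarrow> real"
  assumes cont: "continuous_on (sphere 0 (sqrt 3)) \<phi>"
    and even: "\<And>v. v \<in> sphere 0 (sqrt 3) \<Longrightarrow> \<phi> (- v) = \<phi> v"
  obtains x where "x \<in> sphere 0 1" "\<And>k. \<phi> (vertex k x) = \<phi> (vertex 0 x)"
proof -
  define H where "H = (\<lambda>x. \<phi> (vertex 0 x) *\<^sub>R vertex 0 x + \<phi> (vertex 1 x) *\<^sub>R vertex 1 x
      + \<phi> (vertex 2 x) *\<^sub>R vertex 2 x + \<phi> (vertex 3 x) *\<^sub>R vertex 3 x)"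
  have v: "vertex k x \<in> sphere 0 (sqrt 3)" if "x \<in> sphere 0 1" for k x
    using norm_vertex[OF that] by simp
  have "\<exists>x\<in>sphere 0 1. H x = 0"
  proof (rule ccontr)
    assume "\<not> ?thesis"
    then have H0: "H x \<noteq> 0" if "x \<in> sphere 0 1" for x
      using that by blast
    define P :: "real ^ 3 \<Rightarrow> real \<times> complex" where "P = (\<lambda>w. (w $ 1, Complex (w $ 2) (w $ 3)))"
    have P: "norm (P w) = norm w" for w
      by (simp add: P_def norm_Pair norm_vec_def L2_set_def sum_3 cmod_power2 add.assoc)
    have contP: "continuous_on X P" for X
      unfolding P_def by (intro continuous_intros continuous_on_Complex)
    have "continuous_on (sphere 0 1) (\<lambda>x. \<phi> (vertex k x))" for k
      by (rule continuous_on_compose2[OF cont continuous_on_vertex]) (use v in auto)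
    then have contH: "continuous_on (sphere 0 1) H"
      unfolding H_def by (intro continuous_intros continuous_on_vertex)
    show False
    proof (rule no_equivariant_map_to_sphere[of "\<lambda>x. P (H x /\<^sub>R norm (H x))"])
      show "continuous_on (sphere 0 1) (\<lambda>x. P (H x /\<^sub>R norm (H x)))"
        using H0 by (intro continuous_on_compose2[OF contP[of UNIV]] continuous_intros contH) auto
      fix x :: spinor assume x: "x \<in> sphere 0 1"
      show "norm (P (H x /\<^sub>R norm (H x))) = 1"
        using H0[OF x] by (simp add: P)
      have "H (cscale \<omega> x) = - H x"
        by (simp add: H_def vertex_cscale even[OF v[OF x]] del: One_nat_def)
      then show "P (H (cscale \<omega> x) /\<^sub>R norm (H (cscale \<omega> x))) = - P (H x /\<^sub>R norm (H x))"
        by (simp add: P_def complex_eq_iff)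
      have "H (flip x) = H x"
        by (simp add: H_def vertex_flip del: One_nat_def)
      then show "P (H (flip x) /\<^sub>R norm (H (flip x))) = P (H x /\<^sub>R norm (H x))"
        by simp
    qed
  qed
  then obtain x where x: "x \<in> sphere 0 1" "H x = 0" by blast
  \<comment> \<open>In the frame, \<open>H x = 0\<close> says that the four values have equal sums over both parts of each
    splitting into two pairs.\<close>
  have "H x \<bullet> frame1 x = 0" "H x \<bullet> frame2 x = 0" "H x \<bullet> frame3 x = 0"
    using x(2) by simp_all
  then have "\<phi> (vertex 1 x) = \<phi> (vertex 0 x) \<and> \<phi> (vertex 2 x) = \<phi> (vertex 0 x) \<and> \<phi> (vertex 3 x) = \<phi> (vertex 0 x)"
    unfolding H_def inner_add_left inner_scaleR_left
    by (simp add: vertex_def[of 0 x] vertex_def[of 1 x] vertex_def[of "Suc 0" x] vertex_def[of 2 x] vertex_def[of 3 x]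
       inner_add inner_diff frame_unit[OF x(1)] frame_orthogonal frame_orthogonal[THEN trans[OF inner_commute]])
  moreover have "vertex k x \<in> {vertex 0 x, vertex 1 x, vertex 2 x, vertex 3 x}" for k
    by (simp add: vertex_def)
  ultimately have "\<phi> (vertex k x) = \<phi> (vertex 0 x)" for k
    by (metis insertE emptyE)
  with x(1) that show ?thesis by blast
qed

section \<open>The radial function of a symmetric convex body\<close>

text \<open>The centre is the midpoint of an interior point and its mirror image, so convexity puts it in the
interior.\<close>

lemma symmetric_convex_body_centre_interior:
  fixes K :: "'a::euclidean_space set"
  assumes K: "convex_body K" and sym: "symmetric_about c K"
  shows "c \<in> interior K"
proof -
  have conv: "convex K" and "interior K \<noteq> {}"
    using K by (auto simp: convex_body_def)
  then obtain y where y: "y \<in> interior K" by blast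
  then have "2 *\<^sub>R c - y \<in> closure K"
    using sym interior_subset closure_subset unfolding symmetric_about_def by blast
  from mem_interior_closure_convex_shrink[OF conv y this, of "1/2"]
  have "(2 *\<^sub>R c - y) - (1/2) *\<^sub>R ((2 *\<^sub>R c - y) - y) \<in> interior K"
    by simp
  moreover have "(2 *\<^sub>R c - y) - (1/2) *\<^sub>R ((2 *\<^sub>R c - y) - y) = c"
    by (simp add: algebra_simps scaleR_add_left[symmetric] scaleR_2[symmetric])
  ultimately show ?thesis by simp
qed

lemma symmetric_about_frontier:
  fixes K :: "'a::euclidean_space set"
  assumes "convex_body K" "symmetric_about c K" "c + y \<in> frontier K"
  shows "c - y \<in> frontier K"
proof -
  have img: "(\<lambda>x. 2 *\<^sub>R c - x) ` K = K"
  proof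
    show sub: "(\<lambda>x. 2 *\<^sub>R c - x) ` K \<subseteq> K"
      using assms(2) by (auto simp: symmetric_about_def)
    show "K \<subseteq> (\<lambda>x. 2 *\<^sub>R c - x) ` K"
    proof
      fix x assume "x \<in> K"
      then have "2 *\<^sub>R c - x \<in> K" using sub by blast
      then show "x \<in> (\<lambda>x. 2 *\<^sub>R c - x) ` K"
        by (intro image_eqI[of _ _ "2 *\<^sub>R c - x"]) simp_all
    qed
  qed
  have K: "closed K"
    using assms(1) by (simp add: convex_body_def compact_imp_closed)
  have "interior K = (\<lambda>x. 2 *\<^sub>R c - x) ` interior K"
  proof -
    have "interior ((\<lambda>x. 2 *\<^sub>R c + x) ` uminus ` K) = (\<lambda>x. 2 *\<^sub>R c + x) ` uminus ` interior K"
      by (simp only: interior_translation interior_negations)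
    with img show ?thesis by (simp add: image_image)
  qed
  then have "2 *\<^sub>R c - (c - y) \<in> interior K" if "c - y \<in> interior K"
    using that by blast
  then have "c - y \<in> interior K \<longrightarrow> c + y \<in> interior K"
    by (simp add: scaleR_2)
  moreover have "c - y \<in> K"
  proof -
    have "c + y \<in> K" using assms(3) K by (auto simp: frontier_def)
    then have "2 *\<^sub>R c - (c + y) \<in> K" using assms(2) by (simp add: symmetric_about_def)
    then show ?thesis by (simp add: scaleR_2)
  qed
  ultimately show ?thesis
    using assms(3) K by (auto simp: frontier_def)
qed

text \<open>Every ray from the centre leaves the body exactly once, by convexity. Continuity of the distance
then follows from compactness: its graph is closed since the frontier is, and its values are
bounded.\<close>

lemma radial_function:
  fixes K :: "'a::euclidean_space set"
  assumes K: "convex_body K" and sym: "symmetric_about c K" and R: "0 < R"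
  obtains \<rho> :: "'a \<Rightarrow> real" where "continuous_on (sphere 0 R) \<rho>"
    "\<And>v. v \<in> sphere 0 R \<Longrightarrow> 0 < \<rho> v"
    "\<And>v. v \<in> sphere 0 R \<Longrightarrow> c + \<rho> v *\<^sub>R v \<in> frontier K"
    "\<And>v. v \<in> sphere 0 R \<Longrightarrow> \<rho> (- v) = \<rho> v"
proof -
  have bK: "bounded K" and conv: "convex K" and cl: "closed K"
    using K by (auto simp: convex_body_def compact_imp_bounded compact_imp_closed)
  have c: "c \<in> interior K"
    by (rule symmetric_convex_body_centre_interior[OF K sym])
  have "\<exists>t>0. c + t *\<^sub>R v \<in> frontier K" if "v \<in> sphere 0 R" for v
    using ray_to_frontier[OF bK c, of v] that R by (metis dist_0_norm mem_sphere norm_zero order_less_irrefl)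
  then obtain \<rho> where \<rho>: "\<And>v. v \<in> sphere 0 R \<Longrightarrow> 0 < \<rho> v" 
    "\<And>v. v \<in> sphere 0 R \<Longrightarrow> c + \<rho> v *\<^sub>R v \<in> frontier K"
    by metis
  have less: False if "0 < s" "s < t" "c + s *\<^sub>R v \<in> frontier K" "c + t *\<^sub>R v \<in> frontier K" for s t v
  proof -
    have "c + t *\<^sub>R v \<in> closure K" using that by (simp add: frontier_def)
    from mem_interior_closure_convex_shrink[OF conv c this, of "1 - s / t"]
    have "(c + t *\<^sub>R v) - (1 - s / t) *\<^sub>R ((c + t *\<^sub>R v) - c) \<in> interior K"
      using that by simp
    moreover have "(c + t *\<^sub>R v) - (1 - s / t) *\<^sub>R ((c + t *\<^sub>R v) - c) = c + s *\<^sub>R v"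
      using that by (simp add: algebra_simps)
    ultimately show False using that by (metis DiffD2 frontier_def)
  qed
  have unique: "s = t" if "0 < s" "0 < t" "c + s *\<^sub>R v \<in> frontier K" "c + t *\<^sub>R v \<in> frontier K" for s t v
    using less[of s t v] less[of t s v] that by (meson linorder_cases)
  obtain M where M: "\<And>x. x \<in> K \<Longrightarrow> norm (x - c) \<le> M"
    using bK bounded_any_center[of K c] by (metis dist_commute dist_norm)
  have "continuous_on (sphere 0 R) \<rho>"
  proof (rule continuous_from_closed_graph[of "{0..M / R}"])
    show "\<rho> \<in> sphere 0 R \<rightarrow> {0..M / R}"
    proof
      fix v :: 'a assume v: "v \<in> sphere 0 R"
      then have "norm (\<rho> v *\<^sub>R v) \<le> M"
        using M[of "c + \<rho> v *\<^sub>R v"] \<rho>(2)[OF v] cl by (auto simp: frontier_def)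
      with v \<rho>(1)[OF v] R show "\<rho> v \<in> {0..M / R}"
        by (simp add: field_simps)
    qed
    have "(\<lambda>v. (v, \<rho> v)) ` sphere 0 R = 
      {z. norm (fst z) = R} \<inter> {z. 0 \<le> snd z} \<inter> (\<lambda>z. c + snd z *\<^sub>R fst z) -` frontier K" (is "_ = ?G")
    proof
      show "(\<lambda>v. (v, \<rho> v)) ` sphere 0 R \<subseteq> ?G"
        using \<rho> by (auto intro: less_imp_le)
      show "?G \<subseteq> (\<lambda>v. (v, \<rho> v)) ` sphere 0 R"
      proof
        fix z assume z: "z \<in> ?G"
        then have v: "fst z \<in> sphere 0 R" by simp
        have "snd z \<noteq> 0" 
          using z c by (auto simp: frontier_def)
        then have "snd z = \<rho> (fst z)"
          using z \<rho>[OF v] unique by auto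
        then show "z \<in> (\<lambda>v. (v, \<rho> v)) ` sphere 0 R"
          using v by (intro image_eqI[of _ _ "fst z"]) (simp_all add: prod_eq_iff)
      qed
    qed
    moreover have "closed ?G"
      by (intro closed_Int closed_Collect_eq closed_Collect_le closed_vimage frontier_closed continuous_intros)
    ultimately show "closed ((\<lambda>v. (v, \<rho> v)) ` sphere 0 R)" by simp
  qed simp
  moreover have "\<rho> (- v) = \<rho> v" if "v \<in> sphere 0 R" for v
  proof (rule unique)
    show "c + \<rho> (- v) *\<^sub>R v \<in> frontier K"
      using symmetric_about_frontier[OF K sym \<rho>(2)[of "- v"]] that by simp
  qed (use that \<rho> in auto)
  ultimately show ?thesis using that \<rho> by blast
qed

section \<open>Inscribed cubes\<close>

text \<open>If a coordinate has absolute value below \<open>r\<close>, the point is the midpoint of a segment inside the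
cube in that direction.\<close>

lemma extreme_point_of_cube_coords:
  fixes w :: "real ^ 'n"
  assumes f: "linear f" "inj f" and w: "w \<in> cbox (- vec r) (vec r)"
    and ext: "(c + f w) extreme_point_of ((\<lambda>x. c + f x) ` cbox (- vec r) (vec r))"
  shows "\<bar>w $ i\<bar> = r"
proof (rule ccontr)
  assume "\<bar>w $ i\<bar> \<noteq> r"
  moreover have wk: "\<bar>w $ k\<bar> \<le> r" for k
    using w by (auto simp: mem_box_cart abs_le_iff minus_le_iff)
  ultimately have e: "0 < r - \<bar>w $ i\<bar>"
    by (metis diff_gt_0_iff_gt order_less_le)
  define a where "a = w - axis i (r - \<bar>w $ i\<bar>)"
  define b where "b = w + axis i (r - \<bar>w $ i\<bar>)"
  have "a $ k \<in> {- r..r} \<and> b $ k \<in> {- r..r}" for k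
    using wk[of k] by (cases "k = i") (auto simp: a_def b_def axis_def)
  then have ab: "a \<in> cbox (- vec r) (vec r)" "b \<in> cbox (- vec r) (vec r)"
    by (simp_all add: mem_box_cart)
  have "a $ i \<noteq> b $ i"
    using e by (simp add: a_def b_def axis_def)
  then have "a \<noteq> b" by auto
  then have "c + f a \<noteq> c + f b"
    using f(2) by (auto dest: injD)
  then have "midpoint (c + f a) (c + f b) \<in> open_segment (c + f a) (c + f b)"
    by simp
  moreover have "midpoint (c + f a) (c + f b) = c + f w"
  proof -
    have "f a + f b = 2 *\<^sub>R f w"
      by (simp add: a_def b_def linear_add[OF f(1)] linear_diff[OF f(1)] scaleR_2)
    then have "(c + f a) + (c + f b) = 2 *\<^sub>R (c + f w)"
      by (simp add: scaleR_add_right scaleR_2 algebra_simps)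
    then show ?thesis by (simp add: midpoint_def)
  qed
  ultimately show False
    using ext ab by (auto simp: extreme_point_of_def)
qed

theorem corollary5:
  fixes K :: "(real ^ 3) set" and c :: "real ^ 3"
  assumes "convex_body K" and "symmetric_about c K"
  shows "\<exists>Q. cube_centred_at c Q \<and> inscribed_in Q K"
proof -
  obtain \<rho> :: "real ^ 3 \<Rightarrow> real" where \<rho>: "continuous_on (sphere 0 (sqrt 3)) \<rho>"
    "\<And>v. v \<in> sphere 0 (sqrt 3) \<Longrightarrow> 0 < \<rho> v"
    "\<And>v. v \<in> sphere 0 (sqrt 3) \<Longrightarrow> c + \<rho> v *\<^sub>R v \<in> frontier K"
    "\<And>v. v \<in> sphere 0 (sqrt 3) \<Longrightarrow> \<rho> (- v) = \<rho> v"
    using radial_function[OF assms, of "sqrt 3"] by auto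
  obtain x where x: "x \<in> sphere 0 1" and eq: "\<And>k. \<rho> (vertex k x) = \<rho> (vertex 0 x)"
    using even_function_equal_on_cube_diagonals[OF \<rho>(1) \<rho>(4)] by blast
  define r where "r = \<rho> (vertex 0 x)"
  have v: "vertex k x \<in> sphere 0 (sqrt 3)" for k
    using norm_vertex[OF x] by simp
  have plus: "c + r *\<^sub>R vertex k x \<in> frontier K" for k
    using \<rho>(3)[OF v[of k]] eq[of k] by (simp add: r_def)
  have minus: "c - r *\<^sub>R vertex k x \<in> frontier K" for k
    using symmetric_about_frontier[OF assms plus] .
  have r: "0 < r"
    using \<rho>(2)[OF v] by (simp add: r_def)
  define f where "f = (\<lambda>w :: real ^ 3. w $ 1 *\<^sub>R frame1 x + w $ 2 *\<^sub>R frame2 x + w $ 3 *\<^sub>R frame3 x)"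
  have f: "orthogonal_transformation f"
    unfolding orthogonal_transformation_def
  proof (intro conjI allI)
    show "linear f"
      by (rule linearI) (simp_all add: f_def algebra_simps)
    show "f p \<bullet> f q = p \<bullet> q" for p q
      by (simp add: f_def inner_add frame_unit[OF x] frame_orthogonal
          frame_orthogonal[THEN trans[OF inner_commute]] inner_vec_def[of p q] sum_3)
  qed
  let ?Q = "(\<lambda>w. c + f w) ` cbox (- vec r) (vec r)"
  have "y \<in> frontier K" if ext: "y extreme_point_of ?Q" for y
  proof -
    obtain w where w: "w \<in> cbox (- vec r) (vec r)" "y = c + f w"
      using ext by (auto simp: extreme_point_of_def)
    have "\<bar>w $ i\<bar> = r" for i
      using extreme_point_of_cube_coords[OF orthogonal_transformation_linear[OF f] 
          orthogonal_transformation_inj[OF f] w(1)] ext w(2) by blast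
    then have "w $ i = r \<or> w $ i = - r" for i
      by (metis abs_if minus_minus)
    then have "f w \<in> (\<Union>k. {r *\<^sub>R vertex k x, - (r *\<^sub>R vertex k x)})"
    proof -
      have s: "w $ 1 = r \<or> w $ 1 = - r" "w $ 2 = r \<or> w $ 2 = - r" "w $ 3 = r \<or> w $ 3 = - r"
        using \<open>\<And>i. w $ i = r \<or> w $ i = - r\<close> by blast+
      have "f w \<in> (\<Union>k\<in>{0,1,2,3}. {r *\<^sub>R vertex k x, - (r *\<^sub>R vertex k x)})"
        using s unfolding f_def
        by (elim disjE) (simp_all add: vertex_def algebra_simps)
      then show ?thesis by blast
    qed
    then show ?thesis
      using plus minus w(2) by auto
  qed
  then have "inscribed_in ?Q K"
    by (auto simp: inscribed_in_def)
  moreover have "cube_centred_at c ?Q"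
    unfolding cube_centred_at_def using f r by blast
  ultimately show ?thesis by blast
qed

end
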